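(* Let $R$ be a commutative ring and let $(\mathcal{O},\circ)$ be a graded pre-Lie system over $R$. (i) Let $g\in\mathcal{O}$ be an element of odd degree. Then for all $f\in\mathcal{O}$ one has $$(f\star g)\star g=f\star(g\star g)\quad\text{and}\quad \{f,g\star g\}=-\{g,\{g,f\}\}=-\{g\star g,f\}.$$ (ii) Let $g\in\mathcal{O}$ be an element of odd weight, i.e. $|g|$ is odd. Then for all $f\in\mathcal{O}$ one has $$(f\circ g)\circ g=f\circ(g\circ g)\quad\text{and}\quad [f,g\circ g]=-[g,[g,f]]=-[g\circ g,f].$$
   Context: Let $\mathcal{O}=\bigoplus_{n\in\mathbb{N},i\in\mathbb{Z}}\mathcal{O}^n_i$ be a $(\mathbb{Z},\mathbb{N})$-bigraded $R$-module. For $x\in\mathcal{O}^n_i$, $n$ is the arity of $x$, $i$ its degree, and $|x|=i+n-1$ its weight. No assumption is made on 2-torsion. A graded pre-Lie system on $\mathcal{O}$ is a collection of $R$-linear maps $\circ_k:\mathcal{O}^n_i\otimes\mathcal{O}^m_j\to\mathcal{O}^{n+m-1}_{i+j}$, $1\leq k\leq n$, such that for all $f\in\mathcal{O}^n_i$, $g\in\mathcal{O}^m_j$, $h\in\mathcal{O}^p_l$: $$f\circ_u(g\circ_v h)=(f\circ_u g)\circ_{v+u-1}h\quad (1\leq u\leq n,\ 1\leq v\leq m),$$ $$(f\circ_u g)\circ_{v+m-1}h=(-1)^{jl}(f\circ_v h)\circ_u g\quad (1\leq u<v\leq n).$$ For $f\in\mathcal{O}^n_i$, $g\in\mathcal{O}^m_j$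 define $$f\star g=\sum_{k=1}^n f\circ_k g,\qquad \{f,g\}=f\star g-(-1)^{ij}g\star f,$$ $$f\circ g=(-1)^{|g|(n-1)}\sum_{k=1}^n(-1)^{(m-1)(k-1)}f\circ_k g,\qquad [f,g]=f\circ g-(-1)^{|f||g|}g\circ f,$$ all extended bilinearly to $\mathcal{O}$. *)

theory Defs
  imports Complex_Main
begin

text \<open>
  A bigraded module is given as an internal direct sum: the total module is the whole type
  \<^typ>\<open>'a\<close>, and \<open>gr n i\<close> is the summand of arity \<open>n\<close> and degree \<open>i\<close>.
\<close>

definition is_decomposition :: "(nat \<Rightarrow> int \<Rightarrow> 'a::ab_group_add set) \<Rightarrow> 'a \<Rightarrow> (nat \<Rightarrow> int \<Rightarrow> 'a) \<Rightarrow> bool"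
  where "is_decomposition gr x c \<longleftrightarrow>
    (\<forall>n i. c n i \<in> gr n i) \<and>
    finite {(n, i). c n i \<noteq> 0} \<and>
    x = (\<Sum>(n, i) \<in> {(n, i). c n i \<noteq> 0}. c n i)"

locale bigraded_module = module scale
  for scale :: "'r::comm_ring_1 \<Rightarrow> 'a::ab_group_add \<Rightarrow> 'a" (infixr \<open>*s\<close> 75) +
  fixes gr :: "nat \<Rightarrow> int \<Rightarrow> 'a set"
  assumes subspace_gr: "subspace (gr n i)"
    and direct_sum: "\<exists>!c. is_decomposition gr x c"

definition component :: "(nat \<Rightarrow> int \<Rightarrow> 'a::ab_group_add set) \<Rightarrow> 'a \<Rightarrow> nat \<Rightarrow> int \<Rightarrow> 'a"
  where "component gr x = (THE c. is_decomposition gr x c)"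

definition support :: "(nat \<Rightarrow> int \<Rightarrow> 'a::ab_group_add set) \<Rightarrow> 'a \<Rightarrow> (nat \<times> int) set"
  where "support gr x = {(n, i). component gr x n i \<noteq> 0}"

definition weight :: "nat \<Rightarrow> int \<Rightarrow> int"
  where "weight n i = i + int n - 1"

text \<open>
  Elements of a given degree may have components of several arities, and elements of a given
  weight may have components of several bidegrees; elements of a single summand \<open>gr n i\<close> are a
  special case of both. The zero element has every degree and every weight.
\<close>

definition has_degree :: "(nat \<Rightarrow> int \<Rightarrow> 'a::ab_group_add set) \<Rightarrow> 'a \<Rightarrow> int \<Rightarrow> bool"
  where "has_degree gr x d \<longleftrightarrow> (\<forall>(n, i) \<in> support gr x. i = d)"

definition has_weight :: "(nat \<Rightarrow> int \<Rightarrow> 'a::ab_group_add set) \<Rightarrow> 'a \<Rightarrow> int \<Rightarrow> bool"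
  where "has_weight gr x w \<longleftrightarrow> (\<forall>(n, i) \<in> support gr x. weight n i = w)"

text \<open>\<open>signed e x\<close> is \<open>(-1)^e x\<close>, for an exponent that may be negative.\<close>

definition signed :: "int \<Rightarrow> 'a::ab_group_add \<Rightarrow> 'a"
  where "signed e x = (if even e then x else - x)"

text \<open>
  The maps \<open>\<circ>\<^sub>k\<close> for all bidegrees are bundled into one function
  \<open>circ k\<close>, of which only the values on homogeneous arguments with \<open>1 \<le> k \<le> n\<close> matter. No
  information is lost: distinct summands meet only in 0, where bilinearity forces the value 0.
\<close>

locale graded_pre_Lie_system = bigraded_module scale gr
  for scale :: "'r::comm_ring_1 \<Rightarrow> 'a::ab_group_add \<Rightarrow> 'a" (infixr \<open>*s\<close> 75)
    and gr :: "nat \<Rightarrow> int \<Rightarrow> 'a set" +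
  fixes circ :: "nat \<Rightarrow> 'a \<Rightarrow> 'a \<Rightarrow> 'a"
  assumes circ_closed:
      "\<lbrakk>f \<in> gr n i; g \<in> gr m j; 1 \<le> k; k \<le> n\<rbrakk> \<Longrightarrow> circ k f g \<in> gr (n + m - 1) (i + j)"
    and circ_add_left:
      "\<lbrakk>f \<in> gr n i; f' \<in> gr n i; g \<in> gr m j; 1 \<le> k; k \<le> n\<rbrakk>
        \<Longrightarrow> circ k (f + f') g = circ k f g + circ k f' g"
    and circ_add_right:
      "\<lbrakk>f \<in> gr n i; g \<in> gr m j; g' \<in> gr m j; 1 \<le> k; k \<le> n\<rbrakk>
        \<Longrightarrow> circ k f (g + g') = circ k f g + circ k f g'"
    and circ_scale_left:
      "\<lbrakk>f \<in> gr n i; g \<in> gr m j; 1 \<le> k; k \<le> n\<rbrakk> \<Longrightarrow> circ k (r *s f) g = r *s circ k f g"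
    and circ_scale_right:
      "\<lbrakk>f \<in> gr n i; g \<in> gr m j; 1 \<le> k; k \<le> n\<rbrakk> \<Longrightarrow> circ k f (r *s g) = r *s circ k f g"
    and circ_nested:
      "\<lbrakk>f \<in> gr n i; g \<in> gr m j; h \<in> gr p l; 1 \<le> u; u \<le> n; 1 \<le> v; v \<le> m\<rbrakk>
        \<Longrightarrow> circ u f (circ v g h) = circ (v + u - 1) (circ u f g) h"
    and circ_disjoint:
      "\<lbrakk>f \<in> gr n i; g \<in> gr m j; h \<in> gr p l; 1 \<le> u; u < v; v \<le> n\<rbrakk>
        \<Longrightarrow> circ (v + m - 1) (circ u f g) h = signed (j * l) (circ u (circ v f h) g)"

definition bilinear_extension ::
  "(nat \<Rightarrow> int \<Rightarrow> 'a::ab_group_add set) \<Rightarrow> (nat \<Rightarrow> int \<Rightarrow> nat \<Rightarrow> int \<Rightarrow> 'a \<Rightarrow> 'a \<Rightarrow> 'a) \<Rightarrow> 'a \<Rightarrow> 'a \<Rightarrow> 'a"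
  where "bilinear_extension gr B x y =
    (\<Sum>(n, i) \<in> support gr x. \<Sum>(m, j) \<in> support gr y.
       B n i m j (component gr x n i) (component gr y m j))"

definition star ::
  "(nat \<Rightarrow> int \<Rightarrow> 'a::ab_group_add set) \<Rightarrow> (nat \<Rightarrow> 'a \<Rightarrow> 'a \<Rightarrow> 'a) \<Rightarrow> 'a \<Rightarrow> 'a \<Rightarrow> 'a"
  where "star gr circ = bilinear_extension gr (\<lambda>n i m j f g. \<Sum>k = 1..n. circ k f g)"

definition star_bracket ::
  "(nat \<Rightarrow> int \<Rightarrow> 'a::ab_group_add set) \<Rightarrow> (nat \<Rightarrow> 'a \<Rightarrow> 'a \<Rightarrow> 'a) \<Rightarrow> 'a \<Rightarrow> 'a \<Rightarrow> 'a"
  where "star_bracket gr circ = bilinear_extension gr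
    (\<lambda>n i m j f g. star gr circ f g - signed (i * j) (star gr circ g f))"

definition circle ::
  "(nat \<Rightarrow> int \<Rightarrow> 'a::ab_group_add set) \<Rightarrow> (nat \<Rightarrow> 'a \<Rightarrow> 'a \<Rightarrow> 'a) \<Rightarrow> 'a \<Rightarrow> 'a \<Rightarrow> 'a"
  where "circle gr circ = bilinear_extension gr
    (\<lambda>n i m j f g. signed (weight m j * (int n - 1))
       (\<Sum>k = 1..n. signed ((int m - 1) * (int k - 1)) (circ k f g)))"

definition circle_bracket ::
  "(nat \<Rightarrow> int \<Rightarrow> 'a::ab_group_add set) \<Rightarrow> (nat \<Rightarrow> 'a \<Rightarrow> 'a \<Rightarrow> 'a) \<Rightarrow> 'a \<Rightarrow> 'a \<Rightarrow> 'a"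
  where "circle_bracket gr circ = bilinear_extension gr
    (\<lambda>n i m j f g. circle gr circ f g - signed (weight n i * weight m j) (circle gr circ g f))"

end

theory Submission
  imports Defs
begin

text \<open>
  Both parts are one statement about graded pre-Lie algebras. Let \<open>A(f, g, h) = (f \<star> g) \<star> h - f \<star> (g \<star> h)\<close>
  be the associator of \<open>\<star>\<close>. Expanding both products, the insertions of \<open>h\<close> into \<open>g\<close> cancel by the
  nested relation, and there remain the terms in which \<open>g\<close> and \<open>h\<close> are inserted into two different
  inputs of \<open>f\<close>. Let \<open>D(f, g, h)\<close> be the sum of those in which \<open>g\<close> comes before \<open>h\<close>. The disjoint
  relation rewrites those in which \<open>h\<close> comes first, so that, for \<open>g\<close> of degree \<open>j\<close> and \<open>h\<close> of degree \<open>l\<close>,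
  \<open>A(f, g, h) = D(f, g, h) + (-1)\<^sup>j\<^sup>l D(f, h, g)\<close> (\<open>associator_homogeneous\<close>).

  For odd \<open>j = l\<close> and \<open>g = h\<close> the two terms are \<open>D(f, g, g)\<close> and its negative. Hence
  \<open>A(f, g, g) = 0\<close> identically, and not merely \<open>2 A(f, g, g) = 0\<close>, which is all that the symmetry
  \<open>A(f, g, h) = (-1)\<^sup>j\<^sup>l A(f, h, g)\<close> would give; this is why 2-torsion does no harm
  (\<open>associator_odd\<close>). The bracket identities follow from this vanishing and from the symmetry:
  for \<open>f\<close> of degree \<open>i\<close>,
  \<open>{f, g \<star> g} + {g, {g, f}} = (-1)\<^sup>i A(g, f, g) - A(g, g, f) - A(f, g, g) = 0\<close>.

  The product \<^const>\<open>circle\<close> needs no second computation. If \<open>f \<circ>\<^sub>k g\<close> is multiplied by the sign with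
  which it occurs in \<^const>\<open>circle\<close>, the result is again a graded pre-Lie system, in which the role of
  the degree is taken by the weight (\<open>graded_pre_Lie_system_weight\<close>). Its product and bracket are
  \<^const>\<open>circle\<close> and \<^const>\<open>circle_bracket\<close>, so the second part is the first part for this system.
\<close>

section \<open>Signs\<close>

lemma signed_add: "signed e (x + y) = signed e x + signed e y"
  by (simp add: signed_def)

lemma signed_diff: "signed e (x - y) = signed e x - signed e y"
  by (simp add: signed_def)

lemma signed_zero [simp]: "signed e 0 = 0"
  by (simp add: signed_def)

lemma signed_signed: "signed e (signed e' x) = signed (e + e') x"
  by (simp add: signed_def)

lemma signed_sum: "signed e (\<Sum>k\<in>S. F k) = (\<Sum>k\<in>S. signed e (F k))"
  by (simp add: signed_def sum_negf)

lemma signed_cong: "even (e - e') \<Longrightarrow> signed e x = signed e' x"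
  by (simp add: signed_def)

section \<open>Components and bilinear extension\<close>

context bigraded_module
begin

lemma gr_zero: "0 \<in> gr n i"
  by (rule subspace_0[OF subspace_gr])

lemma gr_add: "x \<in> gr n i \<Longrightarrow> y \<in> gr n i \<Longrightarrow> x + y \<in> gr n i"
  by (rule subspace_add[OF subspace_gr])

lemma gr_scale: "x \<in> gr n i \<Longrightarrow> r *s x \<in> gr n i"
  by (rule subspace_scale[OF subspace_gr])

lemma gr_signed: "x \<in> gr n i \<Longrightarrow> signed e x \<in> gr n i"
  using subspace_neg[OF subspace_gr] by (simp add: signed_def)

lemma gr_sum: "(\<And>k. k \<in> S \<Longrightarrow> F k \<in> gr n i) \<Longrightarrow> (\<Sum>k\<in>S. F k) \<in> gr n i"
  by (rule subspace_sum[OF subspace_gr])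

lemma is_decomposition_component: "is_decomposition gr x (component gr x)"
  unfolding component_def by (rule theI'[OF direct_sum])

lemma component_in_gr: "component gr x n i \<in> gr n i"
  using is_decomposition_component by (simp add: is_decomposition_def)

lemma finite_support: "finite (support gr x)"
  using is_decomposition_component by (simp add: is_decomposition_def support_def)

lemma sum_components: "(\<Sum>(n, i)\<in>support gr x. component gr x n i) = x"
  using is_decomposition_component[of x] by (simp add: is_decomposition_def support_def)

lemma component_outside_support: "(n, i) \<notin> support gr x \<Longrightarrow> component gr x n i = 0"
  by (simp add: support_def)

lemma component_eqI:
  assumes "\<And>n i. c n i \<in> gr n i" and S: "finite S" "\<And>n i. (n, i) \<notin> S \<Longrightarrow> c n i = 0"
    and "x = (\<Sum>(n, i)\<in>S. c n i)"
  shows "component gr x = c"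
proof -
  have sub: "{(n, i). c n i \<noteq> 0} \<subseteq> S"
    using S(2) by auto
  have "(\<Sum>(n, i)\<in>{(n, i). c n i \<noteq> 0}. c n i) = (\<Sum>(n, i)\<in>S. c n i)"
    by (rule sum.mono_neutral_left) (use S sub in auto)
  then have "is_decomposition gr x c"
    using assms sub by (auto simp: is_decomposition_def intro: finite_subset)
  then show ?thesis
    unfolding component_def by (rule the1_equality[OF direct_sum])
qed

lemma component_add: "component gr (x + y) n i = component gr x n i + component gr y n i"
proof -
  let ?S = "support gr x \<union> support gr y"
  have ext: "(\<Sum>(n, i)\<in>?S. component gr z n i) = z" if "support gr z \<subseteq> ?S" for z
  proof -
    have "(\<Sum>(n, i)\<in>support gr z. component gr z n i) = (\<Sum>(n, i)\<in>?S. component gr z n i)"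
      by (rule sum.mono_neutral_left)
        (use that in \<open>auto simp: finite_support component_outside_support\<close>)
    then show ?thesis
      by (simp add: sum_components)
  qed
  have "component gr (x + y) = (\<lambda>n i. component gr x n i + component gr y n i)"
    by (rule component_eqI[where S = ?S])
      (auto simp: component_in_gr gr_add finite_support component_outside_support
        case_prod_unfold sum.distrib ext[unfolded case_prod_unfold])
  then show ?thesis
    by simp
qed

lemma component_homogeneous:
  assumes "x \<in> gr n i"
  shows "component gr x = (\<lambda>n' i'. if n' = n \<and> i' = i then x else 0)"
  by (rule component_eqI[where S = "{(n, i)}"]) (use assms in \<open>auto simp: gr_zero\<close>)

lemma support_homogeneous: "x \<in> gr n i \<Longrightarrow> support gr x = (if x = 0 then {} else {(n, i)})"
  by (auto simp: support_def component_homogeneous)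

lemma support_add: "support gr (x + y) \<subseteq> support gr x \<union> support gr y"
  by (auto simp: support_def component_add)

lemma has_degree_homogeneous: "x \<in> gr n i \<Longrightarrow> has_degree gr x i"
  by (simp add: has_degree_def support_homogeneous)

lemma has_degree_add: "has_degree gr x d \<Longrightarrow> has_degree gr y d \<Longrightarrow> has_degree gr (x + y) d"
  using support_add[of x y] unfolding has_degree_def by blast

text \<open>
  The products, the associator and the brackets are additive in each argument, so the identities
  reduce to homogeneous elements by the following two rules. In the second one all components have
  the given degree and only the arity varies.
\<close>

lemma homogeneous_induct [case_names homogeneous add]:
  assumes hom: "\<And>n i x. x \<in> gr n i \<Longrightarrow> P x"
    and add: "\<And>x y. P x \<Longrightarrow> P y \<Longrightarrow> P (x + y)"
  shows "P x"
proof -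
  have "P (\<Sum>(n, i)\<in>T. component gr x n i)" if "finite T" for T
    using that by (induction T) (auto intro: hom[OF component_in_gr] hom[OF gr_zero] add)
  from this[OF finite_support[of x]] show ?thesis
    by (simp add: sum_components)
qed

lemma has_degree_induct [consumes 1, case_names homogeneous add]:
  assumes "has_degree gr x d"
    and hom: "\<And>n x. x \<in> gr n d \<Longrightarrow> P x"
    and add: "\<And>x y. has_degree gr x d \<Longrightarrow> has_degree gr y d \<Longrightarrow> P x \<Longrightarrow> P y \<Longrightarrow> P (x + y)"
  shows "P x"
proof -
  have "has_degree gr (\<Sum>(n, i)\<in>T. component gr x n i) d \<and> P (\<Sum>(n, i)\<in>T. component gr x n i)"
    if "finite T" "T \<subseteq> support gr x" for T
    using that
  proof (induction T)
    case empty
    show ?case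
      using hom[OF gr_zero] has_degree_homogeneous[OF gr_zero] by simp
  next
    case (insert a T)
    obtain n i where a: "a = (n, i)"
      by (cases a)
    with insert.prems assms(1) have "i = d"
      by (auto simp: has_degree_def)
    then have "component gr x n i \<in> gr n d"
      using component_in_gr by blast
    with insert a show ?case
      by (auto intro: add hom has_degree_add has_degree_homogeneous)
  qed
  from this[OF finite_support subset_refl] show ?thesis
    by (simp add: sum_components)
qed

text \<open>
  The vanishing hypotheses are not automatic: a zero argument has empty support, whereas \<open>B\<close> itself
  is still evaluated at 0 on the right.
\<close>

lemma bilinear_extension_homogeneous:
  assumes "x \<in> gr n i" "y \<in> gr m j" and "B n i m j 0 y = 0" "B n i m j x 0 = 0"
  shows "bilinear_extension gr B x y = B n i m j x y"
  using assms by (auto simp: bilinear_extension_def support_homogeneous component_homogeneous)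

end

locale bidegreewise_biadditive = bigraded_module scale gr
  for scale :: "'r::comm_ring_1 \<Rightarrow> 'a::ab_group_add \<Rightarrow> 'a" (infixr \<open>*s\<close> 75)
    and gr :: "nat \<Rightarrow> int \<Rightarrow> 'a set" +
  fixes B :: "nat \<Rightarrow> int \<Rightarrow> nat \<Rightarrow> int \<Rightarrow> 'a \<Rightarrow> 'a \<Rightarrow> 'a"
  assumes add_left: "\<lbrakk>x \<in> gr n i; x' \<in> gr n i; y \<in> gr m j\<rbrakk>
      \<Longrightarrow> B n i m j (x + x') y = B n i m j x y + B n i m j x' y"
    and add_right: "\<lbrakk>x \<in> gr n i; y \<in> gr m j; y' \<in> gr m j\<rbrakk>
      \<Longrightarrow> B n i m j x (y + y') = B n i m j x y + B n i m j x y'"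
begin

lemma zero_left: "y \<in> gr m j \<Longrightarrow> B n i m j 0 y = 0"
  using add_left[OF gr_zero gr_zero, of y m j n i] by simp

lemma zero_right: "x \<in> gr n i \<Longrightarrow> B n i m j x 0 = 0"
  using add_right[OF _ gr_zero gr_zero, of x n i m j] by simp

abbreviation ext (infixl \<open>\<bullet>\<close> 70) where "x \<bullet> y \<equiv> bilinear_extension gr B x y"

lemma ext_homogeneous: "x \<in> gr n i \<Longrightarrow> y \<in> gr m j \<Longrightarrow> x \<bullet> y = B n i m j x y"
  by (simp add: bilinear_extension_homogeneous zero_left zero_right)

text \<open>
  The support of a sum is only contained in the union of the supports, so additivity is obtained by
  writing all terms as sums over that common index set.
\<close>

lemma ext_eq_sum:
  assumes "finite S" "support gr x \<subseteq> S" "finite T" "support gr y \<subseteq> T"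
  shows "x \<bullet> y = (\<Sum>(n, i)\<in>S. \<Sum>(m, j)\<in>T. B n i m j (component gr x n i) (component gr y m j))"
proof -
  have "x \<bullet> y = (\<Sum>(n, i)\<in>S. \<Sum>(m, j)\<in>support gr y.
      B n i m j (component gr x n i) (component gr y m j))"
    unfolding bilinear_extension_def
    by (rule sum.mono_neutral_left)
      (use assms in \<open>auto simp: component_outside_support zero_left component_in_gr intro!: sum.neutral\<close>)
  also have "\<dots> = (\<Sum>(n, i)\<in>S. \<Sum>(m, j)\<in>T. B n i m j (component gr x n i) (component gr y m j))"
    unfolding case_prod_unfold
    by (intro sum.cong refl sum.mono_neutral_left)
      (use assms in \<open>auto simp: component_outside_support zero_right component_in_gr\<close>)
  finally show ?thesis .
qed

lemma ext_add_left: "(x + x') \<bullet> y = x \<bullet> y + x' \<bullet> y"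
proof -
  let ?S = "support gr x \<union> support gr x'" and ?T = "support gr y"
  have S: "finite ?S" "finite ?T"
    by (simp_all add: finite_support)
  show ?thesis
    unfolding ext_eq_sum[OF S(1) support_add S(2) subset_refl]
      ext_eq_sum[OF S(1) Un_upper1 S(2) subset_refl]
      ext_eq_sum[OF S(1) Un_upper2 S(2) subset_refl]
    by (simp add: component_add add_left component_in_gr sum.distrib case_prod_unfold)
qed

lemma ext_add_right: "x \<bullet> (y + y') = x \<bullet> y + x \<bullet> y'"
proof -
  let ?S = "support gr x" and ?T = "support gr y \<union> support gr y'"
  have S: "finite ?S" "finite ?T"
    by (simp_all add: finite_support)
  show ?thesis
    unfolding ext_eq_sum[OF S(1) subset_refl S(2) support_add]
      ext_eq_sum[OF S(1) subset_refl S(2) Un_upper1]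
      ext_eq_sum[OF S(1) subset_refl S(2) Un_upper2]
    by (simp add: component_add add_right component_in_gr sum.distrib case_prod_unfold)
qed

lemma ext_diff_left: "(x - x') \<bullet> y = x \<bullet> y - x' \<bullet> y"
  using ext_add_left[of "x - x'" x' y] by (simp add: algebra_simps)

lemma ext_diff_right: "x \<bullet> (y - y') = x \<bullet> y - x \<bullet> y'"
  using ext_add_right[of x "y - y'" y'] by (simp add: algebra_simps)

lemma ext_signed_left: "signed e x \<bullet> y = signed e (x \<bullet> y)"
  using ext_diff_left[of 0 0 y] ext_diff_left[of 0 x y] by (simp add: signed_def)

lemma ext_signed_right: "x \<bullet> signed e y = signed e (x \<bullet> y)"
  using ext_diff_right[of x 0 0] ext_diff_right[of x 0 y] by (simp add: signed_def)

end

section \<open>The product of a graded pre-Lie system\<close>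

context graded_pre_Lie_system
begin

abbreviation star_product (infixl \<open>\<star>\<close> 70) where "f \<star> g \<equiv> star gr circ f g"

lemma biadditive_star: "bidegreewise_biadditive scale gr (\<lambda>n i m j f g. \<Sum>k = 1..n. circ k f g)"
  by unfold_locales (simp_all add: circ_add_left circ_add_right sum.distrib)

interpretation star: bidegreewise_biadditive scale gr "\<lambda>n i m j f g. \<Sum>k = 1..n. circ k f g"
  by (rule biadditive_star)

lemmas star_homogeneous = star.ext_homogeneous[folded star_def]
lemmas star_add_left = star.ext_add_left[folded star_def]
lemmas star_add_right = star.ext_add_right[folded star_def]
lemmas star_diff_left = star.ext_diff_left[folded star_def]
lemmas star_diff_right = star.ext_diff_right[folded star_def]
lemmas star_signed_left = star.ext_signed_left[folded star_def]
lemmas star_signed_right = star.ext_signed_right[folded star_def]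

lemma star_in_gr:
  assumes "f \<in> gr n i" "g \<in> gr m j"
  shows "f \<star> g \<in> gr (n + m - 1) (i + j)"
  unfolding star_homogeneous[OF assms] by (rule gr_sum, rule circ_closed[OF assms]) auto

lemma has_degree_star:
  assumes "has_degree gr f i" "has_degree gr g j"
  shows "has_degree gr (f \<star> g) (i + j)"
  using assms(1)
proof (induction rule: has_degree_induct)
  case f: (homogeneous n f)
  show ?case
    using assms(2)
  proof (induction rule: has_degree_induct)
    case (homogeneous m g)
    show ?case
      by (rule has_degree_homogeneous[OF star_in_gr[OF f homogeneous]])
  qed (simp add: star_add_right has_degree_add)
qed (simp add: star_add_left has_degree_add)

definition associator where "associator f g h = (f \<star> g) \<star> h - f \<star> (g \<star> h)"

text \<open>
  The part of \<open>(f \<star> g) \<star> h\<close>, for \<open>f\<close> of arity \<open>n\<close> and \<open>g\<close> of arity \<open>m\<close>, in which \<open>g\<close> and \<open>h\<close> are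
  inserted into the inputs \<open>u < v\<close> of \<open>f\<close>; inserting \<open>g\<close> first moves input \<open>v\<close> to position
  \<open>v + m - 1\<close>.
\<close>

definition disjoint_insertions where
  "disjoint_insertions n m f g h = (\<Sum>u = 1..n. \<Sum>v = u + 1..n. circ (v + m - 1) (circ u f g) h)"

lemma associator_add1: "associator (f + f') g h = associator f g h + associator f' g h"
  by (simp add: associator_def star_add_left)

lemma associator_add2: "associator f (g + g') h = associator f g h + associator f g' h"
  by (simp add: associator_def star_add_left star_add_right)

lemma associator_add3: "associator f g (h + h') = associator f g h + associator f g h'"
  by (simp add: associator_def star_add_right)

lemma circ_sum_left:
  assumes "\<And>u. u \<in> S \<Longrightarrow> F u \<in> gr n i" "g \<in> gr m j" "1 \<le> k" "k \<le> n"
  shows "circ k (\<Sum>u\<in>S. F u) g = (\<Sum>u\<in>S. circ k (F u) g)"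
  using assms(1)
proof (induction S rule: infinite_finite_induct)
  case (insert u S)
  then have "F u \<in> gr n i" "(\<Sum>u\<in>S. F u) \<in> gr n i"
    by (auto intro: gr_sum)
  from circ_add_left[OF this assms(2-4)] insert show ?case
    by simp
qed (use circ_add_left[OF gr_zero gr_zero assms(2-4)] in simp_all)

lemma circ_sum_right:
  assumes "\<And>v. v \<in> S \<Longrightarrow> G v \<in> gr m j" "f \<in> gr n i" "1 \<le> k" "k \<le> n"
  shows "circ k f (\<Sum>v\<in>S. G v) = (\<Sum>v\<in>S. circ k f (G v))"
  using assms(1)
proof (induction S rule: infinite_finite_induct)
  case (insert v S)
  then have "G v \<in> gr m j" "(\<Sum>v\<in>S. G v) \<in> gr m j"
    by (auto intro: gr_sum)
  from circ_add_right[OF assms(2) this assms(3,4)] insert show ?case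
    by simp
qed (use circ_add_right[OF assms(2) gr_zero gr_zero assms(3,4)] in simp_all)

text \<open>
  After \<open>g\<close> has been inserted at \<open>u\<close>, the inputs of \<open>f \<circ>\<^sub>u g\<close> at positions \<open>u, \<dots>, u + m - 1\<close> are
  those of \<open>g\<close>, the later ones are the inputs \<open>v > u\<close> of \<open>f\<close>, and the earlier ones the inputs
  \<open>v < u\<close> of \<open>f\<close>. The first kind gives \<open>f \<star> (g \<star> h)\<close>, the other two the two summands.
\<close>

lemma associator_homogeneous:
  assumes f: "f \<in> gr n i" and g: "g \<in> gr m j" and h: "h \<in> gr p l"
  shows "associator f g h
    = disjoint_insertions n m f g h + signed (j * l) (disjoint_insertions n p f h g)"
proof -
  have fg: "circ u f g \<in> gr (n + m - 1) (i + j)" if "u \<in> {1..n}" for u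
    by (rule circ_closed[OF f g]) (use that in auto)
  have gh: "circ v g h \<in> gr (m + p - 1) (j + l)" if "v \<in> {1..m}" for v
    by (rule circ_closed[OF g h]) (use that in auto)
  have "(f \<star> g) \<star> h = (\<Sum>k = 1..n + m - 1. circ k (\<Sum>u = 1..n. circ u f g) h)"
    unfolding star_homogeneous[OF star_in_gr[OF f g] h] unfolding star_homogeneous[OF f g] ..
  also have "\<dots> = (\<Sum>k = 1..n + m - 1. \<Sum>u = 1..n. circ k (circ u f g) h)"
    by (rule sum.cong[OF refl], rule circ_sum_left[OF fg h]) auto
  also have "\<dots> = (\<Sum>u = 1..n. \<Sum>k = 1..n + m - 1. circ k (circ u f g) h)"
    by (rule sum.swap)
  also have "\<dots> = (\<Sum>u = 1..n. (\<Sum>v = u + 1..n. circ (v + m - 1) (circ u f g) h)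
      + (\<Sum>v = 1..m. circ (v + u - 1) (circ u f g) h) + (\<Sum>v = 1..<u. circ v (circ u f g) h))"
  proof (rule sum.cong[OF refl])
    fix u assume u: "u \<in> {1..n}"
    let ?c = "\<lambda>k. circ k (circ u f g) h"
    \<comment> \<open>Inputs of \<open>f\<close> after \<open>u\<close>, inputs of \<open>g\<close>, inputs of \<open>f\<close> before \<open>u\<close>; for \<open>m = 0\<close> the middle part is empty.\<close>
    have split: "{1..n + m - 1} = {u + m..n + m - 1} \<union> {u..<u + m} \<union> {1..<u}"
      using u by auto
    have "sum ?c {1..n + m - 1} = sum ?c {u + m..n + m - 1} + sum ?c {u..<u + m} + sum ?c {1..<u}"
      unfolding split using u by (subst sum.union_disjoint; fastforce?)+
    moreover have "sum ?c {u + m..n + m - 1} = (\<Sum>v = u + 1..n. ?c (v + m - 1))"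
      using u by (intro sum.reindex_bij_witness[of _ "\<lambda>v. v + m - 1" "\<lambda>k. k + 1 - m"]) auto
    moreover have "sum ?c {u..<u + m} = (\<Sum>v = 1..m. ?c (v + u - 1))"
      using u by (intro sum.reindex_bij_witness[of _ "\<lambda>v. v + u - 1" "\<lambda>k. k + 1 - u"]) auto
    ultimately show "sum ?c {1..n + m - 1} = (\<Sum>v = u + 1..n. ?c (v + m - 1))
        + (\<Sum>v = 1..m. ?c (v + u - 1)) + sum ?c {1..<u}"
      by simp
  qed
  finally have left: "(f \<star> g) \<star> h = disjoint_insertions n m f g h
      + (\<Sum>u = 1..n. \<Sum>v = 1..m. circ (v + u - 1) (circ u f g) h)
      + (\<Sum>u = 1..n. \<Sum>v = 1..<u. circ v (circ u f g) h)"
    by (simp add: disjoint_insertions_def sum.distrib)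
  have "f \<star> (g \<star> h) = (\<Sum>u = 1..n. circ u f (\<Sum>v = 1..m. circ v g h))"
    unfolding star_homogeneous[OF f star_in_gr[OF g h]] unfolding star_homogeneous[OF g h] ..
  also have "\<dots> = (\<Sum>u = 1..n. \<Sum>v = 1..m. circ u f (circ v g h))"
    by (rule sum.cong[OF refl], rule circ_sum_right[OF gh f]) auto
  also have "\<dots> = (\<Sum>u = 1..n. \<Sum>v = 1..m. circ (v + u - 1) (circ u f g) h)"
    by (intro sum.cong refl, rule circ_nested[OF f g h]) auto
  finally have nested: "f \<star> (g \<star> h) = (\<Sum>u = 1..n. \<Sum>v = 1..m. circ (v + u - 1) (circ u f g) h)" .
  have "(\<Sum>u = 1..n. \<Sum>v = 1..<u. circ v (circ u f g) h)
      = (\<Sum>v = 1..n. \<Sum>u = v + 1..n. circ v (circ u f g) h)"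
    by (subst (1 2) sum.Sigma)
      (auto intro!: sum.reindex_bij_witness[of _ prod.swap prod.swap])
  also have "\<dots> = (\<Sum>v = 1..n. \<Sum>u = v + 1..n.
      signed (j * l) (circ (u + p - 1) (circ v f h) g))"
  proof (intro sum.cong refl)
    fix v u
    assume "v \<in> {1..n}" "u \<in> {v + 1..n}"
    then have "circ (u + p - 1) (circ v f h) g = signed (l * j) (circ v (circ u f g) h)"
      by (intro circ_disjoint[OF f h g]) auto
    then show "circ v (circ u f g) h = signed (j * l) (circ (u + p - 1) (circ v f h) g)"
      by (auto simp: signed_def)
  qed
  finally have "(\<Sum>u = 1..n. \<Sum>v = 1..<u. circ v (circ u f g) h)
      = signed (j * l) (disjoint_insertions n p f h g)"
    by (simp add: disjoint_insertions_def signed_sum)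
  with left nested show ?thesis
    by (simp add: associator_def)
qed

text \<open>
  In the homogeneous case multiplication by \<open>(-1)\<^sup>j\<^sup>l\<close> exchanges the two summands of the associator.
\<close>

lemma associator_symmetric:
  assumes "has_degree gr g j" "has_degree gr h l"
  shows "associator f g h = signed (j * l) (associator f h g)"
proof (induction f rule: homogeneous_induct)
  case f: (homogeneous n i f)
  show ?case
    using assms(1)
  proof (induction rule: has_degree_induct)
    case g: (homogeneous m g)
    show ?case
      using assms(2)
    proof (induction rule: has_degree_induct)
      case h: (homogeneous p h)
      show ?case
        by (simp add: associator_homogeneous[OF f g h] associator_homogeneous[OF f h g]
            signed_add signed_signed mult.commute) (simp add: signed_def)
    qed (simp add: associator_add2 associator_add3 signed_add)
  qed (simp add: associator_add2 associator_add3 signed_add)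
qed (simp add: associator_add1 signed_add)

text \<open>
  If \<open>g\<close> is homogeneous, the two summands of \<open>A(f, g, g)\<close> cancel. If \<open>g = x + y\<close>, the mixed terms
  \<open>A(f, x, y)\<close> and \<open>A(f, y, x)\<close> cancel by symmetry.
\<close>

lemma associator_odd:
  assumes "has_degree gr g d" "odd d"
  shows "associator f g g = 0"
  using assms(1)
proof (induction rule: has_degree_induct)
  case g: (homogeneous m g)
  show ?case
  proof (induction f rule: homogeneous_induct)
    case f: (homogeneous n i f)
    show ?case
      using \<open>odd d\<close> by (simp add: associator_homogeneous[OF f g g] signed_def)
  qed (simp add: associator_add1)
next
  case (add x y)
  have "associator f x y = - associator f y x"
    using associator_symmetric[OF add.hyps] \<open>odd d\<close> by (simp add: signed_def)
  with add.IH show ?case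
    by (simp add: associator_add2 associator_add3)
qed

section \<open>The bracket of a graded pre-Lie system\<close>

abbreviation lie_bracket (\<open>\<lbrace>_,/ _\<rbrace>\<close>) where "\<lbrace>f, g\<rbrace> \<equiv> star_bracket gr circ f g"

lemma biadditive_star_bracket:
  "bidegreewise_biadditive scale gr (\<lambda>n i m j f g. f \<star> g - signed (i * j) (g \<star> f))"
  by unfold_locales (simp_all add: star_add_left star_add_right signed_add)

interpretation bracket:
  bidegreewise_biadditive scale gr "\<lambda>n i m j f g. f \<star> g - signed (i * j) (g \<star> f)"
  by (rule biadditive_star_bracket)

lemmas star_bracket_homogeneous = bracket.ext_homogeneous[folded star_bracket_def]
lemmas star_bracket_add_left = bracket.ext_add_left[folded star_bracket_def]
lemmas star_bracket_add_right = bracket.ext_add_right[folded star_bracket_def]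

text \<open>
  The sign depends only on the degrees, so the defining formula holds without homogeneity in the
  arity; \<open>g \<star> g\<close> and \<open>{g, f}\<close> are in general not homogeneous in the arity.
\<close>

lemma star_bracket_has_degree:
  assumes "has_degree gr f i" "has_degree gr g j"
  shows "\<lbrace>f, g\<rbrace> = f \<star> g - signed (i * j) (g \<star> f)"
  using assms(1)
proof (induction rule: has_degree_induct)
  case f: (homogeneous n f)
  show ?case
    using assms(2)
  proof (induction rule: has_degree_induct)
    case g: (homogeneous m g)
    show ?case
      by (rule star_bracket_homogeneous[OF f g])
  qed (simp add: star_bracket_add_right star_add_left star_add_right signed_add)
qed (simp add: star_bracket_add_left star_add_left star_add_right signed_add)

lemma has_degree_star_bracket:
  assumes "has_degree gr f i" "has_degree gr g j"
  shows "has_degree gr \<lbrace>f, g\<rbrace> (i + j)"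
  using assms(1)
proof (induction rule: has_degree_induct)
  case f: (homogeneous n f)
  show ?case
    using assms(2)
  proof (induction rule: has_degree_induct)
    case g: (homogeneous m g)
    have "- signed (i * j) (g \<star> f) \<in> gr (n + m - 1) (i + j)"
      using gr_signed[OF gr_signed[OF star_in_gr[OF g f]], of 1 "i * j"]
      by (simp add: signed_def add.commute)
    with star_in_gr[OF f g] have "\<lbrace>f, g\<rbrace> \<in> gr (n + m - 1) (i + j)"
      using gr_add by (fastforce simp: star_bracket_homogeneous[OF f g])
    then show ?case
      by (rule has_degree_homogeneous)
  qed (simp add: star_bracket_add_right has_degree_add)
qed (simp add: star_bracket_add_left has_degree_add)

text \<open>
  The degree of \<open>g \<star> g\<close> is even, so both brackets are plain commutators.
\<close>

lemma star_bracket_square_antisymmetric: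
  assumes "has_degree gr g d" "odd d"
  shows "\<lbrace>f, g \<star> g\<rbrace> = - \<lbrace>g \<star> g, f\<rbrace>"
proof (induction f rule: homogeneous_induct)
  case (homogeneous n i f)
  note deg = has_degree_homogeneous[OF homogeneous] has_degree_star[OF assms(1) assms(1)]
  show ?case
    by (simp add: star_bracket_has_degree[OF deg] star_bracket_has_degree[OF deg(2,1)] signed_def)
qed (simp add: star_bracket_add_left star_bracket_add_right)

text \<open>
  For \<open>f\<close> of degree \<open>i\<close> the sign of \<open>{g, f}\<close> is \<open>(-1)\<^sup>i\<close> and that of the outer bracket
  \<open>(-1)\<^sup>i\<^sup>+\<^sup>1\<close>, since \<open>g\<close> is odd. Expanded, the difference of the two sides is a combination of
  associators.
\<close>

lemma star_bracket_square:
  assumes g: "has_degree gr g d" and "odd d"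
  shows "\<lbrace>f, g \<star> g\<rbrace> = - \<lbrace>g, \<lbrace>g, f\<rbrace>\<rbrace>"
proof (induction f rule: homogeneous_induct)
  case (homogeneous n i f)
  note f = has_degree_homogeneous[OF homogeneous]
  have "\<lbrace>f, g \<star> g\<rbrace> = f \<star> (g \<star> g) - (g \<star> g) \<star> f"
    by (simp add: star_bracket_has_degree[OF f has_degree_star[OF g g]] signed_def)
  moreover have "\<lbrace>g, \<lbrace>g, f\<rbrace>\<rbrace>
      = g \<star> (g \<star> f) - signed i (g \<star> (f \<star> g)) + signed i ((g \<star> f) \<star> g) - (f \<star> g) \<star> g"
    unfolding star_bracket_has_degree[OF g has_degree_star_bracket[OF g f]]
    unfolding star_bracket_has_degree[OF g f]
    using \<open>odd d\<close>
    by (simp add: star_diff_left star_diff_right star_signed_left star_signed_right signed_diff)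
      (simp add: signed_def)
  ultimately have "\<lbrace>f, g \<star> g\<rbrace> + \<lbrace>g, \<lbrace>g, f\<rbrace>\<rbrace>
      = signed i (associator g f g) - associator g g f - associator f g g"
    by (simp add: associator_def signed_diff)
  also have "associator g g f = signed i (associator g f g)"
    unfolding associator_symmetric[OF g f, of g] using \<open>odd d\<close> by (simp add: signed_def)
  also have "associator f g g = 0"
    by (rule associator_odd[OF assms])
  finally show ?case
    by (simp add: eq_neg_iff_add_eq_0)
qed (simp add: star_bracket_add_left star_bracket_add_right)

theorem star_odd_square:
  assumes "has_degree gr g d" "odd d"
  shows "(f \<star> g) \<star> g = f \<star> (g \<star> g)"
    and "\<lbrace>f, g \<star> g\<rbrace> = - \<lbrace>g, \<lbrace>g, f\<rbrace>\<rbrace>"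
    and "- \<lbrace>g, \<lbrace>g, f\<rbrace>\<rbrace> = - \<lbrace>g \<star> g, f\<rbrace>"
  using associator_odd[OF assms, of f] star_bracket_square[OF assms, of f]
    star_bracket_square_antisymmetric[OF assms, of f]
  by (simp_all add: associator_def)

end

section \<open>Regrading by weight\<close>

text \<open>
  The same module, with weight in place of degree: the summand of arity \<open>n\<close> and weight \<open>w\<close> is the
  one of arity \<open>n\<close> and degree \<open>w - n + 1\<close>.
\<close>

definition weight_gr :: "(nat \<Rightarrow> int \<Rightarrow> 'a set) \<Rightarrow> nat \<Rightarrow> int \<Rightarrow> 'a set"
  where "weight_gr gr n w = gr n (w - int n + 1)"

text \<open>
  On homogeneous elements this is \<open>circ k f g\<close> with the sign that it carries in \<^const>\<open>circle\<close>. The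
  sign depends on the bidegrees of \<open>f\<close> and \<open>g\<close>, but the composition has only the elements themselves
  as arguments; passing to components recovers the bidegrees.
\<close>

definition weight_circ ::
  "(nat \<Rightarrow> int \<Rightarrow> 'a::ab_group_add set) \<Rightarrow> (nat \<Rightarrow> 'a \<Rightarrow> 'a \<Rightarrow> 'a) \<Rightarrow> nat \<Rightarrow> 'a \<Rightarrow> 'a \<Rightarrow> 'a"
  where "weight_circ gr circ k = bilinear_extension gr
    (\<lambda>n i m j f g. signed (weight m j * (int n - 1) + (int m - 1) * (int k - 1)) (circ k f g))"

lemma weight_of_shift: "weight n (w - int n + 1) = w"
  by (simp add: weight_def)

text \<open>
  For a fixed arity, weight and degree differ by a constant, so sets and sums indexed by bidegree
  can be reindexed along \<open>(n, i) \<mapsto> (n, weight n i)\<close>.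
\<close>

lemma Collect_weight:
  "{(n, w). P n w} = (\<lambda>(n, i). (n, weight n i)) ` {(n, i). P n (weight n i)}"
proof (intro equalityI subsetI)
  fix a assume "a \<in> {(n, w). P n w}"
  then obtain n w where "a = (n, weight n (w - int n + 1))" "P n (weight n (w - int n + 1))"
    by (auto simp: weight_of_shift)
  then show "a \<in> (\<lambda>(n, i). (n, weight n i)) ` {(n, i). P n (weight n i)}"
    by (intro image_eqI[of _ _ "(n, w - int n + 1)"]) auto
qed auto

lemma inj_on_weight: "inj_on (\<lambda>(n, i). (n, weight n i)) S"
  by (auto simp: inj_on_def weight_def)

lemma weight_gr_weight: "weight_gr gr n (weight n i) = gr n i"
  by (simp add: weight_gr_def weight_def)

context bigraded_module
begin

lemma is_decomposition_weight_gr: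
  "is_decomposition (weight_gr gr) x c \<longleftrightarrow> is_decomposition gr x (\<lambda>n i. c n (weight n i))"
proof -
  have "(\<forall>n w. c n w \<in> weight_gr gr n w) \<longleftrightarrow> (\<forall>n i. c n (weight n i) \<in> gr n i)"
    by (metis weight_of_shift weight_gr_weight)
  then show ?thesis
    unfolding is_decomposition_def Collect_weight[of "\<lambda>n w. c n w \<noteq> 0"]
      finite_image_iff[OF inj_on_weight] sum.reindex[OF inj_on_weight]
    by (simp add: case_prod_unfold)
qed

lemma bigraded_module_weight_gr: "bigraded_module scale (weight_gr gr)"
proof unfold_locales
  show "subspace (weight_gr gr n i)" for n i
    unfolding weight_gr_def by (rule subspace_gr)
  show "\<exists>!c. is_decomposition (weight_gr gr) x c" for x
  proof -
    obtain c where c: "is_decomposition gr x c"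
      and unique: "\<And>c'. is_decomposition gr x c' \<Longrightarrow> c' = c"
      using direct_sum[of x] by auto
    show ?thesis
    proof (rule ex1I)
      show "is_decomposition (weight_gr gr) x (\<lambda>n w. c n (w - int n + 1))"
        using c by (simp add: is_decomposition_weight_gr weight_def)
    next
      fix c' assume "is_decomposition (weight_gr gr) x c'"
      then have "c = (\<lambda>n i. c' n (weight n i))"
        using unique by (simp add: is_decomposition_weight_gr)
      then show "c' = (\<lambda>n w. c n (w - int n + 1))"
        by (simp add: weight_of_shift)
    qed
  qed
qed

lemma component_weight_gr: "component (weight_gr gr) x n (weight n i) = component gr x n i"
proof -
  interpret weight: bigraded_module scale "weight_gr gr"
    by (rule bigraded_module_weight_gr)
  have "is_decomposition gr x (\<lambda>n i. component (weight_gr gr) x n (weight n i))"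
    using weight.is_decomposition_component by (simp add: is_decomposition_weight_gr)
  then have "component gr x = (\<lambda>n i. component (weight_gr gr) x n (weight n i))"
    unfolding component_def[of gr] by (rule the1_equality[OF direct_sum])
  then show ?thesis
    by simp
qed

lemma support_weight_gr: "support (weight_gr gr) x = (\<lambda>(n, i). (n, weight n i)) ` support gr x"
  unfolding support_def Collect_weight[of "\<lambda>n w. component (weight_gr gr) x n w \<noteq> 0"]
  by (simp add: component_weight_gr)

lemma has_degree_weight_gr: "has_degree (weight_gr gr) x w \<longleftrightarrow> has_weight gr x w"
  by (auto simp: has_degree_def has_weight_def support_weight_gr)

lemma bilinear_extension_weight_gr:
  assumes "\<And>n i m j x y. x \<in> gr n i \<Longrightarrow> y \<in> gr m j
    \<Longrightarrow> B' n (weight n i) m (weight m j) x y = B n i m j x y"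
  shows "bilinear_extension (weight_gr gr) B' = bilinear_extension gr B"
proof (intro ext)
  fix x y
  show "bilinear_extension (weight_gr gr) B' x y = bilinear_extension gr B x y"
    unfolding bilinear_extension_def support_weight_gr sum.reindex[OF inj_on_weight]
    by (simp add: case_prod_unfold component_weight_gr assms component_in_gr)
qed

end

context graded_pre_Lie_system
begin

lemma weight_circ_homogeneous:
  assumes f: "f \<in> gr n i" and g: "g \<in> gr m j" and k: "1 \<le> k" "k \<le> n"
  shows "weight_circ gr circ k f g
    = signed (weight m j * (int n - 1) + (int m - 1) * (int k - 1)) (circ k f g)"
proof -
  have "circ k 0 g = 0" "circ k f 0 = 0"
    using circ_add_left[OF gr_zero gr_zero g k] circ_add_right[OF f gr_zero gr_zero k] by simp_all
  with f g show ?thesis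
    unfolding weight_circ_def by (subst bilinear_extension_homogeneous) auto
qed

lemma circ_signed_left:
  assumes "f \<in> gr n i" "g \<in> gr m j" "1 \<le> k" "k \<le> n"
  shows "circ k (signed e f) g = signed e (circ k f g)"
  using circ_scale_left[OF assms, of "- 1"] by (simp add: signed_def)

lemma circ_signed_right:
  assumes "f \<in> gr n i" "g \<in> gr m j" "1 \<le> k" "k \<le> n"
  shows "circ k f (signed e g) = signed e (circ k f g)"
  using circ_scale_right[OF assms, of "- 1"] by (simp add: signed_def)

lemma weight_circ_closed:
  assumes "f \<in> gr n i" "g \<in> gr m j" "1 \<le> k" "k \<le> n"
  shows "weight_circ gr circ k f g \<in> gr (n + m - 1) (i + j)"
  unfolding weight_circ_homogeneous[OF assms] by (rule gr_signed[OF circ_closed[OF assms]])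

text \<open>
  The signs on both sides agree because they only accumulate: with \<open>\<bar>g\<bar>\<close>, \<open>\<bar>h\<bar>\<close> the weights, each side
  carries \<open>(\<bar>g\<bar> + \<bar>h\<bar>)(n - 1) + \<bar>h\<bar>(m - 1) + (m - 1)(u - 1) + (p - 1)(u + v - 2)\<close> modulo 2.
\<close>

lemma weight_circ_nested:
  assumes f: "f \<in> gr n i" and g: "g \<in> gr m j" and h: "h \<in> gr p l"
    and u: "1 \<le> u" "u \<le> n" and v: "1 \<le> v" "v \<le> m"
  shows "weight_circ gr circ u f (weight_circ gr circ v g h)
    = weight_circ gr circ (v + u - 1) (weight_circ gr circ u f g) h"
proof -
  have vu: "1 \<le> v + u - 1" "v + u - 1 \<le> n + m - 1"
    using u v by auto
  have parity: "even ((weight (m + p - 1) (j + l) * (int n - 1) + (int (m + p - 1) - 1) * (int u - 1)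
        + (weight p l * (int m - 1) + (int p - 1) * (int v - 1)))
      - (weight p l * (int (n + m - 1) - 1) + (int p - 1) * (int (v + u - 1) - 1)
        + (weight m j * (int n - 1) + (int m - 1) * (int u - 1))))"
    using u v by (simp add: weight_def of_nat_diff algebra_simps)
  show ?thesis
    unfolding weight_circ_homogeneous[OF f weight_circ_closed[OF g h v] u]
      weight_circ_homogeneous[OF weight_circ_closed[OF f g u] h vu]
    unfolding weight_circ_homogeneous[OF g h v] weight_circ_homogeneous[OF f g u]
      circ_signed_right[OF f circ_closed[OF g h v] u]
      circ_signed_left[OF circ_closed[OF f g u] h vu]
      signed_signed circ_nested[OF f g h u v]
    by (rule signed_cong[OF parity])
qed

text \<open>
  Interchanging \<open>g\<close> and \<open>h\<close> changes the exponent of the sign by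
  \<open>\<bar>h\<bar>(m - 1) + (p - 1)(m - 1) - \<bar>g\<bar>(p - 1) \<equiv> l(m - 1) + j(p - 1) + (m - 1)(p - 1)\<close> modulo 2.
  Together with the exponent \<open>j l\<close> of the original relation this is
  \<open>(j + m - 1)(l + p - 1) = \<bar>g\<bar>\<bar>h\<bar>\<close>, the exponent that the weight grading requires.
\<close>

lemma weight_circ_disjoint:
  assumes f: "f \<in> gr n i" and g: "g \<in> gr m j" and h: "h \<in> gr p l"
    and uv: "1 \<le> u" "u < v" "v \<le> n"
  shows "weight_circ gr circ (v + m - 1) (weight_circ gr circ u f g) h
    = signed (weight m j * weight p l)
        (weight_circ gr circ u (weight_circ gr circ v f h) g)"
proof -
  have u: "1 \<le> u" "u \<le> n" "u \<le> n + p - 1"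
    and v: "1 \<le> v" "v \<le> n" "1 \<le> v + m - 1" "v + m - 1 \<le> n + m - 1"
    using uv by auto
  have parity: "even ((weight p l * (int (n + m - 1) - 1) + (int p - 1) * (int (v + m - 1) - 1)
        + (weight m j * (int n - 1) + (int m - 1) * (int u - 1) + j * l))
      - (weight m j * weight p l
        + (weight m j * (int (n + p - 1) - 1) + (int m - 1) * (int u - 1)
        + (weight p l * (int n - 1) + (int p - 1) * (int v - 1)))))"
    using uv by (simp add: weight_def of_nat_diff algebra_simps)
  show ?thesis
    unfolding weight_circ_homogeneous[OF weight_circ_closed[OF f g u(1,2)] h v(3,4)]
      weight_circ_homogeneous[OF weight_circ_closed[OF f h v(1,2)] g u(1,3)]
    unfolding weight_circ_homogeneous[OF f g u(1,2)] weight_circ_homogeneous[OF f h v(1,2)]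
      circ_signed_left[OF circ_closed[OF f g u(1,2)] h v(3,4)]
      circ_signed_left[OF circ_closed[OF f h v(1,2)] g u(1,3)]
      circ_disjoint[OF f g h uv] signed_signed
    by (rule signed_cong[OF parity])
qed

lemma scale_signed: "r *s signed e x = signed e (r *s x)"
  by (simp add: signed_def)

text \<open>
  All sign conventions of \<^const>\<open>circle\<close> are absorbed here: they are exactly what turns a pre-Lie
  system graded by degree into one graded by weight.
\<close>

lemma graded_pre_Lie_system_weight:
  "graded_pre_Lie_system scale (weight_gr gr) (weight_circ gr circ)"
proof (intro graded_pre_Lie_system.intro graded_pre_Lie_system_axioms.intro
    bigraded_module_weight_gr; unfold weight_gr_def)
  fix f f' g g' h :: 'a and n m p k u v :: nat and i j l :: int and r :: 'r
  assume f: "f \<in> gr n (i - int n + 1)" and g: "g \<in> gr m (j - int m + 1)"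
  {
    assume k: "1 \<le> k" "k \<le> n"
    have degree: "i - int n + 1 + (j - int m + 1) = i + j - int (n + m - 1) + 1"
      using k by simp
    show "weight_circ gr circ k f g \<in> gr (n + m - 1) (i + j - int (n + m - 1) + 1)"
      using weight_circ_closed[OF f g k] unfolding degree .
    show "weight_circ gr circ k (f + f') g = weight_circ gr circ k f g + weight_circ gr circ k f' g"
      if f': "f' \<in> gr n (i - int n + 1)"
      by (simp add: weight_circ_homogeneous[OF gr_add[OF f f'] g k]
          weight_circ_homogeneous[OF f g k] weight_circ_homogeneous[OF f' g k]
          circ_add_left[OF f f' g k] signed_add)
    show "weight_circ gr circ k f (g + g') = weight_circ gr circ k f g + weight_circ gr circ k f g'"
      if g': "g' \<in> gr m (j - int m + 1)"
      by (simp add: weight_circ_homogeneous[OF f gr_add[OF g g'] k]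
          weight_circ_homogeneous[OF f g k] weight_circ_homogeneous[OF f g' k]
          circ_add_right[OF f g g' k] signed_add)
    show "weight_circ gr circ k (r *s f) g = r *s weight_circ gr circ k f g"
      by (simp add: weight_circ_homogeneous[OF gr_scale[OF f] g k]
          weight_circ_homogeneous[OF f g k] circ_scale_left[OF f g k] scale_signed)
    show "weight_circ gr circ k f (r *s g) = r *s weight_circ gr circ k f g"
      by (simp add: weight_circ_homogeneous[OF f gr_scale[OF g] k]
          weight_circ_homogeneous[OF f g k] circ_scale_right[OF f g k] scale_signed)
  }
  assume h: "h \<in> gr p (l - int p + 1)"
  show "weight_circ gr circ u f (weight_circ gr circ v g h)
      = weight_circ gr circ (v + u - 1) (weight_circ gr circ u f g) h"
    if "1 \<le> u" "u \<le> n" "1 \<le> v" "v \<le> m"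
    by (rule weight_circ_nested[OF f g h that])
  show "weight_circ gr circ (v + m - 1) (weight_circ gr circ u f g) h
      = signed (j * l) (weight_circ gr circ u (weight_circ gr circ v f h) g)"
    if "1 \<le> u" "u < v" "v \<le> n"
    using weight_circ_disjoint[OF f g h that] by (simp add: weight_of_shift)
qed

lemma circle_eq_star_weight: "circle gr circ = star (weight_gr gr) (weight_circ gr circ)"
  unfolding circle_def star_def
  by (rule bilinear_extension_weight_gr[symmetric])
    (simp add: weight_circ_homogeneous signed_sum signed_signed)

lemma circle_bracket_eq_star_bracket_weight:
  "circle_bracket gr circ = star_bracket (weight_gr gr) (weight_circ gr circ)"
  unfolding circle_bracket_def star_bracket_def circle_eq_star_weight
  by (rule bilinear_extension_weight_gr[symmetric]) simp

end

theorem lemma1p10: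
  fixes scale :: "'r::comm_ring_1 \<Rightarrow> 'a::ab_group_add \<Rightarrow> 'a"
    and gr :: "nat \<Rightarrow> int \<Rightarrow> 'a set"
    and circ :: "nat \<Rightarrow> 'a \<Rightarrow> 'a \<Rightarrow> 'a"
  assumes "graded_pre_Lie_system scale gr circ"
  shows "(\<forall>g d. has_degree gr g d \<and> odd d \<longrightarrow>
           (\<forall>f. star gr circ (star gr circ f g) g = star gr circ f (star gr circ g g) \<and>
                star_bracket gr circ f (star gr circ g g)
                  = - star_bracket gr circ g (star_bracket gr circ g f) \<and>
                - star_bracket gr circ g (star_bracket gr circ g f)
                  = - star_bracket gr circ (star gr circ g g) f)) \<and>
         (\<forall>g w. has_weight gr g w \<and> odd w \<longrightarrow>
           (\<forall>f. circle gr circ (circle gr circ f g) g = circle gr circ f (circle gr circ g g) \<and>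
                circle_bracket gr circ f (circle gr circ g g)
                  = - circle_bracket gr circ g (circle_bracket gr circ g f) \<and>
                - circle_bracket gr circ g (circle_bracket gr circ g f)
                  = - circle_bracket gr circ (circle gr circ g g) f))"
proof -
  interpret graded_pre_Lie_system scale gr circ
    by (rule assms)
  interpret weight: graded_pre_Lie_system scale "weight_gr gr" "weight_circ gr circ"
    by (rule graded_pre_Lie_system_weight)
  show ?thesis
    unfolding circle_eq_star_weight circle_bracket_eq_star_bracket_weight
      has_degree_weight_gr[symmetric]
    using star_odd_square weight.star_odd_square by blast
qed

end
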